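(* For every $k \in \{1,2,3,4,5\}$ we have $\mathrm{minvdeg}(\mathcal{MU}_{\delta=k}) = \mathrm{minvdeg}(\mathcal{UHIT}_{\delta=k}) = \mathrm{N}(k)$.
   Context: Literals come with a fixed-point-free involution $x \mapsto \overline{x}$; variables are positive literals. A clause is a finite set $C$ of literals with $C \cap \overline{C} = \emptyset$; a clause-set is a finite set of clauses. $\mathrm{var}(F)$, $n(F) = |\mathrm{var}(F)|$, $c(F) = |F|$, $\delta(F) = c(F) - n(F)$. $\mathcal{MU}$ is the class of minimally unsatisfiable clause-sets (unsatisfiable, but removing any clause gives a satisfiable clause-set). $F$ is hitting if for all distinct $C, D \in F$, $C \cap \overline{D} \ne \emptyset$; $\mathcal{UHIT}$ is the class of unsatisfiable hitting clause-sets. $\mathcal{C}_{\delta=k} = \{F \in \mathcal{C} : \delta(F) = k\}$. $\mathrm{ld}_F(x)$ is the number of clauses containing $x$, $\mathrm{vdeg}_F(v) = \mathrm{ld}_F(v)+\mathrm{ld}_F(\overline{v})$, $\mathrm{minvdeg}(F) = \min_{v \in \mathrm{var}(F)} \mathrm{vdeg}_F(v)$; for a class $\mathcal{D}$, $\mathrm{minvdeg}(\mathcal{D})$ is the supremum of $\mathrm{minvdeg}(F)$ over $F \in \mathcal{D}$ with $n(F) > 0$. $\mathrm{N}(1) = 2$, $\mathrm{N}(k) = \max_{i \in \{2,\dots,k\}} \min(2i, \mathrm{N}(k-i+1)+i)$ for $k \ge 2$. *)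

theory Defs
  imports Main "HOL-Library.Extended_Nat"
begin

text \<open>Variables are natural numbers; a literal is a pair (variable, sign),
  where (v, True) is the positive literal v (identified with the variable v)
  and (v, False) is its complement.\<close>

type_synonym lit = "nat \<times> bool"

definition comp :: "lit \<Rightarrow> lit" where
  "comp l = (fst l, \<not> snd l)"

definition is_clause :: "lit set \<Rightarrow> bool" where
  "is_clause C \<longleftrightarrow> finite C \<and> C \<inter> comp ` C = {}"

definition is_clause_set :: "lit set set \<Rightarrow> bool" where
  "is_clause_set F \<longleftrightarrow> finite F \<and> (\<forall>C\<in>F. is_clause C)"

definition vars :: "lit set set \<Rightarrow> nat set" where
  "vars F = fst ` (\<Union>F)"

definition nvars :: "lit set set \<Rightarrow> nat" where
  "nvars F = card (vars F)"

definition ncls :: "lit set set \<Rightarrow> nat" where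
  "ncls F = card F"

definition deficiency :: "lit set set \<Rightarrow> int" where
  "deficiency F = int (ncls F) - int (nvars F)"

definition satisfiable :: "lit set set \<Rightarrow> bool" where
  "satisfiable F \<longleftrightarrow> (\<exists>\<phi> :: nat \<Rightarrow> bool. \<forall>C\<in>F. \<exists>l\<in>C. \<phi> (fst l) = snd l)"

definition MU :: "lit set set set" where
  "MU = {F. is_clause_set F \<and> \<not> satisfiable F \<and> (\<forall>C\<in>F. satisfiable (F - {C}))}"

definition hitting :: "lit set set \<Rightarrow> bool" where
  "hitting F \<longleftrightarrow> (\<forall>C\<in>F. \<forall>D\<in>F. C \<noteq> D \<longrightarrow> C \<inter> comp ` D \<noteq> {})"

definition UHIT :: "lit set set set" where
  "UHIT = {F. is_clause_set F \<and> hitting F \<and> \<not> satisfiable F}"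

definition delta_class :: "lit set set set \<Rightarrow> int \<Rightarrow> lit set set set" where
  "delta_class D k = {F \<in> D. deficiency F = k}"

definition ld :: "lit set set \<Rightarrow> lit \<Rightarrow> nat" where
  "ld F x = card {C \<in> F. x \<in> C}"

definition vdeg :: "lit set set \<Rightarrow> nat \<Rightarrow> nat" where
  "vdeg F v = ld F (v, True) + ld F (v, False)"

definition minvdeg :: "lit set set \<Rightarrow> nat" where
  "minvdeg F = Min (vdeg F ` vars F)"

text \<open>Supremum over the class (in the extended naturals, so an unbounded class gives \<infinity>).\<close>
definition minvdeg_class :: "lit set set set \<Rightarrow> enat" where
  "minvdeg_class D = (SUP F \<in> {F \<in> D. nvars F > 0}. enat (minvdeg F))"

function NN :: "nat \<Rightarrow> nat" where
  "NN k = (if k = 0 then 0 else if k = 1 then 2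
           else Max (set (map (\<lambda>i. min (2*i) (NN (k - i + 1) + i)) [2..<k+1])))"
  by auto
termination
  by (relation "measure id") auto

end

theory Submission
  imports Defs
begin

text \<open>The upper bound holds for all \<open>k\<close>. Adding literals to clauses as long as unsatisfiability is
  preserved turns a minimally unsatisfiable clause-set into a saturated one with the same variables
  and the same number of clauses, without decreasing any degree. For saturated \<open>F\<close>, setting a
  literal \<open>x\<close> to true again yields a minimally unsatisfiable clause-set. If the variable of \<open>x\<close> has
  minimum degree \<open>m\<close> then no other variable disappears, so the deficiency changes from \<open>k\<close> to
  \<open>k - i + 1\<close>, where \<open>i\<close> is the degree of \<open>x\<close>. Choosing \<open>x\<close> as the more frequent of the two literals
  gives \<open>m \<le> 2 i\<close>, and a variable of minimum degree after the assignment gives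
  \<open>m \<le> N(k - i + 1) + i\<close>. That the deficiency is positive (Tarsi's lemma) comes out of the
  same induction. For the lower bound, take all clauses over \<open>1\<close>, \<open>2\<close> or \<open>3\<close> variables
  (\<open>k = 1, 2, 5\<close>), and merge one or two pairs of clauses over \<open>3\<close> variables (\<open>k = 4, 3\<close>).\<close>

declare NN.simps [simp del]

section \<open>Literals, minimal unsatisfiability and variable degrees\<close>

lemma fst_comp [simp]: "fst (comp l) = fst l"
  by (simp add: comp_def)

lemma snd_comp [simp]: "snd (comp l) \<longleftrightarrow> \<not> snd l"
  by (simp add: comp_def)

lemma comp_comp [simp]: "comp (comp l) = l"
  by (simp add: comp_def)

lemma comp_neq [simp]: "comp l \<noteq> l" "l \<noteq> comp l"
  by (auto simp: comp_def prod_eq_iff)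

lemma same_var_iff: "fst l = fst x \<longleftrightarrow> l = x \<or> l = comp x"
  by (auto simp: comp_def prod_eq_iff)

lemma is_clause_iff: "is_clause C \<longleftrightarrow> finite C \<and> (\<forall>l\<in>C. comp l \<notin> C)"
proof -
  have "C \<inter> comp ` C = {} \<longleftrightarrow> (\<forall>l\<in>C. comp l \<notin> C)"
    by (auto simp: disjoint_iff image_iff) (metis comp_comp prod.collapse)
  then show ?thesis by (simp add: is_clause_def)
qed

definition sat_clause :: "(nat \<Rightarrow> bool) \<Rightarrow> lit set \<Rightarrow> bool" where
  "sat_clause \<phi> C \<longleftrightarrow> (\<exists>l\<in>C. \<phi> (fst l) = snd l)"

lemma satisfiable_iff: "satisfiable F \<longleftrightarrow> (\<exists>\<phi>. \<forall>C\<in>F. sat_clause \<phi> C)"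
  by (simp add: satisfiable_def sat_clause_def)

lemma sat_clause_mono: "sat_clause \<phi> C \<Longrightarrow> C \<subseteq> D \<Longrightarrow> sat_clause \<phi> D"
  by (auto simp: sat_clause_def)

lemma finite_vars: "is_clause_set F \<Longrightarrow> finite (vars F)"
  by (auto simp: vars_def is_clause_set_def is_clause_def)

lemma MU_clause_set: "F \<in> MU \<Longrightarrow> is_clause_set F"
  and MU_finite: "F \<in> MU \<Longrightarrow> finite F"
  and MU_clause: "F \<in> MU \<Longrightarrow> C \<in> F \<Longrightarrow> is_clause C"
  and MU_unsat: "F \<in> MU \<Longrightarrow> \<not> satisfiable F"
  by (auto simp: MU_def is_clause_set_def)

text \<open>An assignment satisfying \<open>F - {C}\<close> must falsify \<open>C\<close>, since
  \<open>F\<close> is unsatisfiable. All later uses of minimality go through such an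
  assignment.\<close>

lemma MU_witness:
  assumes "F \<in> MU" "C \<in> F"
  obtains \<phi> where "\<not> sat_clause \<phi> C" "\<And>D. D \<in> F \<Longrightarrow> D \<noteq> C \<Longrightarrow> sat_clause \<phi> D"
proof -
  obtain \<phi> where \<phi>: "\<forall>D\<in>F - {C}. sat_clause \<phi> D"
    using assms by (auto simp: MU_def satisfiable_iff)
  moreover have "\<not> (\<forall>D\<in>F. sat_clause \<phi> D)"
    using MU_unsat[OF assms(1)] by (auto simp: satisfiable_iff)
  ultimately show thesis using that[of \<phi>] by blast
qed

text \<open>An assignment falsifying \<open>D\<close> alone would satisfy \<open>C\<close> and hence
  its superset \<open>D\<close>.\<close>

lemma MU_antichain:
  assumes "F \<in> MU" "C \<in> F" "D \<in> F" "C \<subseteq> D"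
  shows "C = D"
  using MU_witness[OF assms(1,3)] assms(2,4) sat_clause_mono by metis

text \<open>Pure literal argument: if \<open>x\<close> occurred nowhere, take an assignment
  satisfying all clauses except one that contains \<open>comp x\<close>. Making
  \<open>comp x\<close> true repairs that clause and breaks no other.\<close>

lemma MU_literal_occurs:
  assumes "F \<in> MU" "fst x \<in> vars F"
  obtains C where "C \<in> F" "x \<in> C"
proof (rule ccontr)
  assume "\<not> thesis"
  then have nx: "\<And>C. C \<in> F \<Longrightarrow> x \<notin> C" using that by blast
  obtain C l where C: "C \<in> F" "l \<in> C" "fst l = fst x"
    using assms(2) by (auto simp: vars_def)
  then have xC: "comp x \<in> C" using nx same_var_iff by metis
  obtain \<phi> where \<phi>: "\<And>D. D \<in> F \<Longrightarrow> D \<noteq> C \<Longrightarrow> sat_clause \<phi> D"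
    using MU_witness[OF assms(1) C(1)] by metis
  define \<psi> where "\<psi> = \<phi>(fst x := snd (comp x))"
  have "sat_clause \<psi> D" if "D \<in> F" for D
  proof (cases "comp x \<in> D")
    case True
    then show ?thesis by (auto simp: sat_clause_def \<psi>_def intro!: bexI[of _ "comp x"])
  next
    case False
    then have "sat_clause \<phi> D" using \<phi> that xC by blast
    moreover have "fst l \<noteq> fst x" if "l \<in> D" for l
      using False nx \<open>D \<in> F\<close> that same_var_iff by metis
    ultimately show ?thesis by (auto simp: sat_clause_def \<psi>_def)
  qed
  then show False using MU_unsat[OF assms(1)] by (auto simp: satisfiable_iff)
qed

lemma ld_pos:
  assumes "F \<in> MU" "fst x \<in> vars F"
  shows "ld F x > 0"
  using MU_literal_occurs[OF assms] MU_finite[OF assms(1)]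
  by (auto simp: ld_def card_gt_0_iff)

definition occs :: "lit set set \<Rightarrow> nat \<Rightarrow> lit set set" where
  "occs F v = {C \<in> F. v \<in> fst ` C}"

text \<open>No clause contains both literals of \<open>v\<close>, so nothing is counted twice.
  Degrees can then be compared by injections between sets of clauses.\<close>

lemma vdeg_eq_card_occs:
  assumes "is_clause_set F"
  shows "vdeg F v = card (occs F v)"
proof -
  have "v \<in> fst ` C \<longleftrightarrow> (v, True) \<in> C \<or> (v, False) \<in> C" for C :: "lit set"
    by (simp add: Domain_fst[symmetric] Domain_iff ex_bool_eq)
  then have "occs F v = {C \<in> F. (v, True) \<in> C} \<union> {C \<in> F. (v, False) \<in> C}"
    by (auto simp: occs_def)
  moreover have "(v, False) \<notin> C" if "C \<in> F" "(v, True) \<in> C" for C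
    using assms that unfolding is_clause_set_def is_clause_iff comp_def
    by (metis (full_types) fst_conv snd_conv)
  then have "{C \<in> F. (v, True) \<in> C} \<inter> {C \<in> F. (v, False) \<in> C} = {}" by blast
  ultimately show ?thesis
    using assms by (simp add: vdeg_def ld_def card_Un_disjoint is_clause_set_def)
qed

lemma vdeg_eq_ld_comp: "vdeg F (fst x) = ld F x + ld F (comp x)"
  by (cases x; cases "snd x") (auto simp: vdeg_def comp_def)

subsection \<open>Saturation\<close>

text \<open>Restricting to literals over \<open>vars F\<close> keeps the deficiency fixed while
  saturating and bounds the process.\<close>

definition saturated :: "lit set set \<Rightarrow> bool" where
  "saturated F \<longleftrightarrow> (\<forall>C\<in>F. \<forall>x. fst x \<in> vars F \<longrightarrow> x \<notin> C \<longrightarrow> comp x \<notin> C \<longrightarrow>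
     satisfiable (insert (insert x C) (F - {C})))"

text \<open>The witness for \<open>C\<close> also serves \<open>insert x C\<close>, and every other
  witness satisfies \<open>C\<close>, hence the larger clause. By the antichain property the new
  clause is not yet in \<open>F\<close>, so the number of clauses is kept.\<close>

lemma MU_extend_clause:
  assumes F: "F \<in> MU" and C: "C \<in> F" and x: "fst x \<in> vars F" "x \<notin> C" "comp x \<notin> C"
    and unsat: "\<not> satisfiable (insert (insert x C) (F - {C}))" (is "\<not> satisfiable ?G")
  shows "?G \<in> MU" "insert x C \<notin> F" "vars ?G = vars F" "\<And>y. ld F y \<le> ld ?G y"
proof -
  show new: "insert x C \<notin> F" using MU_antichain[OF F C] x by blast
  have "is_clause (insert x C)"
    using MU_clause[OF F C] x by (auto simp: is_clause_iff)
  then have "is_clause_set ?G"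
    using MU_clause_set[OF F] by (auto simp: is_clause_set_def)
  moreover have "satisfiable (?G - {D})" if D: "D \<in> ?G" for D
  proof (cases "D = insert x C")
    case True
    obtain \<phi> where "\<And>D. D \<in> F \<Longrightarrow> D \<noteq> C \<Longrightarrow> sat_clause \<phi> D"
      using MU_witness[OF F C] by metis
    then show ?thesis using True by (auto simp: satisfiable_iff)
  next
    case False
    then have "D \<in> F" "D \<noteq> C" using D by auto
    then obtain \<phi> where "\<And>E. E \<in> F \<Longrightarrow> E \<noteq> D \<Longrightarrow> sat_clause \<phi> E"
      using MU_witness[OF F, of D] by metis
    moreover from this have "sat_clause \<phi> (insert x C)"
      using C \<open>D \<noteq> C\<close> sat_clause_mono[of \<phi> C "insert x C"] by blast
    ultimately show ?thesis by (auto simp: satisfiable_iff)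
  qed
  ultimately show "?G \<in> MU" using unsat by (simp add: MU_def)
  have "F = insert C (F - {C})" using C by auto
  then have "vars F = fst ` C \<union> vars (F - {C})"
    by (metis Sup_insert image_Un vars_def)
  then show "vars ?G = vars F" using x(1) by (auto simp: vars_def)
  show "ld F y \<le> ld ?G y" for y
    unfolding ld_def
  proof (rule card_inj_on_le[where f = "\<lambda>D. if D = C then insert x C else D"])
    show "inj_on (\<lambda>D. if D = C then insert x C else D) {D \<in> F. y \<in> D}"
      using new by (auto simp: inj_on_def)
    show "finite {D \<in> ?G. y \<in> D}" using MU_finite[OF F] by simp
  qed auto
qed

lemma saturation_exists:
  assumes "F \<in> MU"
  shows "\<exists>G\<in>MU. saturated G \<and> vars G = vars F \<and> card G = card F \<and> (\<forall>y. ld F y \<le> ld G y)"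
  using assms
\<comment> \<open>The measure counts the literals over \<open>vars F\<close> missing from the
  clauses; each extension lowers it by one.\<close>
proof (induction "\<Sum>C\<in>F. card (vars F \<times> (UNIV :: bool set)) - card C"
    arbitrary: F rule: less_induct)
  case less
  show ?case
  proof (cases "saturated F")
    case True
    then show ?thesis using less.prems by blast
  next
    case False
    then obtain C x where C: "C \<in> F" and x: "fst x \<in> vars F" "x \<notin> C" "comp x \<notin> C"
      and unsat: "\<not> satisfiable (insert (insert x C) (F - {C}))"
      by (auto simp: saturated_def)
    let ?G = "insert (insert x C) (F - {C})"
    let ?L = "vars F \<times> (UNIV :: bool set)"
    note G = MU_extend_clause[OF less.prems C x unsat]
    have finF: "finite F" using MU_finite[OF less.prems] .
    have finL: "finite ?L" using finite_vars[OF MU_clause_set[OF less.prems]] by simp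
    have finC: "finite C" using MU_clause[OF less.prems C] by (simp add: is_clause_def)
    \<comment> \<open>Strictness matters: it makes the truncated difference for \<open>C\<close>
      positive, so that it really drops.\<close>
    have "C \<subset> ?L"
    proof
      show "C \<subseteq> ?L" using C by (force simp: vars_def)
      show "C \<noteq> ?L" using x(1,2) by (metis UNIV_I mem_Times_iff)
    qed
    then have "card C < card ?L" using finL psubset_card_mono by blast
    then have "card ?L - card (insert x C) < card ?L - card C"
      using finC x(2) by simp
    moreover have "(\<Sum>D\<in>F. card ?L - card D)
        = (card ?L - card C) + (\<Sum>D\<in>F - {C}. card ?L - card D)"
      using finF C by (rule sum.remove)
    moreover have "(\<Sum>D\<in>?G. card ?L - card D)
        = (card ?L - card (insert x C)) + (\<Sum>D\<in>F - {C}. card ?L - card D)"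
      using finF G(2) by simp
    ultimately have "(\<Sum>D\<in>?G. card (vars ?G \<times> (UNIV :: bool set)) - card D)
        < (\<Sum>D\<in>F. card ?L - card D)"
      unfolding G(3) by linarith
    from less.hyps[OF this G(1)] obtain H where H: "H \<in> MU" "saturated H" "vars H = vars ?G"
      "card H = card ?G" "\<forall>y. ld ?G y \<le> ld H y" by blast
    have "card ?G = card F" using finF G(2) card_Suc_Diff1[OF finF C] by simp
    moreover have "ld F y \<le> ld H y" for y using G(4) H(5) le_trans by blast
    ultimately show ?thesis using H(1-4) G(3) by auto
  qed
qed

subsection \<open>Splitting\<close>

text \<open>The result of assigning true to \<open>x\<close>.\<close>

definition split :: "lit set set \<Rightarrow> lit \<Rightarrow> lit set set" where
  "split F x = (\<lambda>C. C - {comp x}) ` {C \<in> F. x \<notin> C}"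

text \<open>Clauses that differ at most in \<open>comp x\<close> are comparable, so the antichain
  property identifies them.\<close>

lemma split_inj:
  assumes "F \<in> MU"
  shows "inj_on (\<lambda>C. C - {comp x}) F"
proof (rule inj_onI)
  fix C D assume CD: "C \<in> F" "D \<in> F" "C - {comp x} = D - {comp x}"
  then have "C \<subseteq> D \<or> D \<subseteq> C" by blast
  then show "C = D" using MU_antichain[OF assms] CD by metis
qed

text \<open>Minimality requires, for each surviving clause \<open>C\<close>, an assignment that
  makes \<open>x\<close> true and satisfies all other clauses of \<open>F\<close>; saturation
  supplies it when \<open>comp x\<close> is not in \<open>C\<close>.\<close>

lemma split_MU:
  assumes F: "F \<in> MU" and sat: "saturated F" and x: "fst x \<in> vars F"
  shows "split F x \<in> MU"
proof -
  have clause: "is_clause_set (split F x)"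
    using MU_clause_set[OF F] by (auto simp: is_clause_set_def split_def is_clause_iff)
  have unsat: "\<not> satisfiable (split F x)"
  proof
    assume "satisfiable (split F x)"
    then obtain \<phi> where \<phi>: "\<And>C. C \<in> F \<Longrightarrow> x \<notin> C \<Longrightarrow> sat_clause \<phi> (C - {comp x})"
      by (auto simp: satisfiable_iff split_def)
    have "sat_clause (\<phi>(fst x := snd x)) C" if C: "C \<in> F" for C
    proof (cases "x \<in> C")
      case True
      then show ?thesis by (auto simp: sat_clause_def)
    next
      case False
      then obtain l where "l \<in> C" "l \<noteq> comp x" "\<phi> (fst l) = snd l"
        using \<phi>[OF C] by (auto simp: sat_clause_def)
      moreover from this have "fst l \<noteq> fst x" using False same_var_iff by metis
      ultimately show ?thesis by (auto simp: sat_clause_def)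
    qed
    then show False using MU_unsat[OF F] by (auto simp: satisfiable_iff)
  qed
  have crit: "satisfiable (split F x - {C - {comp x}})" if C: "C \<in> F" "x \<notin> C" for C
  proof -
    have "\<exists>\<phi>. (\<forall>D\<in>F - {C}. sat_clause \<phi> D) \<and> \<phi> (fst x) = snd x"
    proof (cases "comp x \<in> C")
      case True
      obtain \<phi> where \<phi>: "\<not> sat_clause \<phi> C" "\<And>D. D \<in> F \<Longrightarrow> D \<noteq> C \<Longrightarrow> sat_clause \<phi> D"
        using MU_witness[OF F C(1)] by metis
      have "\<phi> (fst (comp x)) \<noteq> snd (comp x)" using \<phi>(1) True unfolding sat_clause_def by blast
      then show ?thesis using \<phi>(2) by auto
    next
      case False
      then have "satisfiable (insert (insert x C) (F - {C}))"
        using sat C x unfolding saturated_def by blast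
      then obtain \<phi> where \<phi>: "sat_clause \<phi> (insert x C)" "\<forall>D\<in>F - {C}. sat_clause \<phi> D"
        by (auto simp: satisfiable_iff)
      \<comment> \<open>The extended clause holds but \<open>C\<close> fails, so the added literal
        \<open>x\<close> must be the true one.\<close>
      then have "\<not> sat_clause \<phi> C"
        using MU_unsat[OF F] unfolding satisfiable_iff by blast
      then have "\<phi> (fst x) = snd x" using \<phi>(1) by (simp add: sat_clause_def)
      then show ?thesis using \<phi>(2) by blast
    qed
    then obtain \<phi> where \<phi>: "\<forall>D\<in>F - {C}. sat_clause \<phi> D" "\<phi> (fst x) = snd x" by blast
    have "sat_clause \<phi> (D - {comp x})" if "D \<in> F" "D - {comp x} \<noteq> C - {comp x}" for D
    proof -
      have "sat_clause \<phi> D" using \<phi>(1) that by blast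
      then obtain l where "l \<in> D" "\<phi> (fst l) = snd l"
        unfolding sat_clause_def by blast
      moreover from this have "l \<noteq> comp x" using \<phi>(2) by auto
      ultimately show ?thesis by (auto simp: sat_clause_def)
    qed
    then have "\<forall>D\<in>split F x - {C - {comp x}}. sat_clause \<phi> D"
      unfolding split_def by blast
    then show ?thesis unfolding satisfiable_iff by blast
  qed
  have "satisfiable (split F x - {C})" if "C \<in> split F x" for C
  proof -
    obtain D where "D \<in> F" "x \<notin> D" "C = D - {comp x}"
      using \<open>C \<in> split F x\<close> unfolding split_def by blast
    then show ?thesis using crit by blast
  qed
  then show ?thesis using clause unsat by (simp add: MU_def)
qed

lemma card_split:
  assumes "F \<in> MU"
  shows "card (split F x) + ld F x = card F"
proof -
  have fin: "finite F" using MU_finite[OF assms] .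
  have "card (split F x) = card {C \<in> F. x \<notin> C}"
    unfolding split_def
    by (rule card_image) (rule inj_on_subset[OF split_inj[OF assms]], blast)
  moreover have "card F = card ({C \<in> F. x \<notin> C} \<union> {C \<in> F. x \<in> C})"
    by (rule arg_cong[of _ _ card]) blast
  ultimately show ?thesis
    using fin by (subst (asm) card_Un_disjoint) (auto simp: ld_def)
qed

text \<open>Only clauses containing \<open>x\<close> are lost, and by \<open>split_inj\<close> the
  surviving ones do not merge.\<close>

lemma vdeg_le_vdeg_split:
  assumes F: "F \<in> MU" and G: "split F x \<in> MU" and w: "w \<noteq> fst x"
  shows "vdeg F w \<le> vdeg (split F x) w + ld F x"
proof -
  let ?A = "{C \<in> F. x \<notin> C \<and> w \<in> fst ` C}"
  have fin: "finite F" using MU_finite[OF F] .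
  have "vdeg F w = card (occs F w)"
    using vdeg_eq_card_occs[OF MU_clause_set[OF F]] .
  also have "\<dots> \<le> card (?A \<union> {C \<in> F. x \<in> C})"
    using fin by (intro card_mono) (auto simp: occs_def)
  also have "\<dots> \<le> card ?A + ld F x"
    unfolding ld_def by (rule card_Un_le)
  also have "card ?A \<le> card (occs (split F x) w)"
  proof (rule card_inj_on_le)
    show "inj_on (\<lambda>C. C - {comp x}) ?A"
      by (rule inj_on_subset[OF split_inj[OF F]]) blast
    show "finite (occs (split F x) w)"
      using fin by (simp add: occs_def split_def)
    have "w \<in> fst ` (C - {comp x})" if "w \<in> fst ` C" for C
    proof -
      obtain l where "l \<in> C" "w = fst l" using \<open>w \<in> fst ` C\<close> by blast
      moreover from this have "l \<noteq> comp x" using w by auto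
      ultimately show ?thesis by blast
    qed
    then show "(\<lambda>C. C - {comp x}) ` ?A \<subseteq> occs (split F x) w"
      by (auto simp: occs_def split_def)
  qed
  also have "card (occs (split F x) w) = vdeg (split F x) w"
    using vdeg_eq_card_occs[OF MU_clause_set[OF G]] by simp
  finally show ?thesis by simp
qed

text \<open>A vanishing variable other than that of \<open>x\<close> would occur only in clauses containing \<open>x\<close>,
  contradicting minimality since \<open>comp x\<close> occurs too.\<close>

lemma vars_split:
  assumes F: "F \<in> MU" and G: "split F x \<in> MU" and x: "fst x \<in> vars F"
    and min: "\<And>w. w \<in> vars F \<Longrightarrow> vdeg F (fst x) \<le> vdeg F w"
  shows "vars (split F x) = vars F - {fst x}"
proof
  show "vars (split F x) \<subseteq> vars F - {fst x}"
    by (auto simp: vars_def split_def) (metis prod.collapse fst_conv same_var_iff)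
  show "vars F - {fst x} \<subseteq> vars (split F x)"
  proof
    fix w assume w: "w \<in> vars F - {fst x}"
    have "ld F x < vdeg F (fst x)"
      using ld_pos[OF F, of "comp x"] x by (simp add: vdeg_eq_ld_comp)
    also have "\<dots> \<le> vdeg F w" using min w by blast
    also have "\<dots> \<le> vdeg (split F x) w + ld F x"
      using vdeg_le_vdeg_split[OF F G] w by blast
    finally have "occs (split F x) w \<noteq> {}"
      using vdeg_eq_card_occs[OF MU_clause_set[OF G]] by auto
    then show "w \<in> vars (split F x)" by (auto simp: occs_def vars_def)
  qed
qed

subsection \<open>The upper bound\<close>

lemma NN_1: "NN 1 = 2"
  by (simp add: NN.simps)

lemma NN_lower:
  assumes "2 \<le> i" "i \<le> k"
  shows "min (2 * i) (NN (k - i + 1) + i) \<le> NN k"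
proof -
  have eq: "NN k = Max (set (map (\<lambda>i. min (2*i) (NN (k - i + 1) + i)) [2..<k+1]))"
    using assms by (subst NN.simps) simp
  have mem: "min (2 * i) (NN (k - i + 1) + i)
      \<in> set (map (\<lambda>i. min (2*i) (NN (k - i + 1) + i)) [2..<k+1])"
    unfolding set_map using assms by (intro imageI) auto
  show ?thesis unfolding eq by (rule Max_ge[OF List.finite_set mem])
qed

text \<open>For \<open>k \<ge> 2\<close> the choice \<open>i = 2\<close> in the recursion suffices.
  This settles the case of a literal of degree 1 in \<open>MU_bound\<close>.\<close>

lemma NN_ge_2: "k \<ge> 1 \<Longrightarrow> NN k \<ge> 2"
  using NN_1 NN_lower[of 2 k] by (cases "k = 1") auto

lemma minvdeg_le: "is_clause_set F \<Longrightarrow> v \<in> vars F \<Longrightarrow> minvdeg F \<le> vdeg F v"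
  unfolding minvdeg_def using finite_vars by (intro Min_le) auto

lemma minvdeg_attained:
  assumes "is_clause_set F" "nvars F > 0"
  obtains v where "v \<in> vars F" "vdeg F v = minvdeg F"
proof -
  have "minvdeg F \<in> vdeg F ` vars F"
    unfolding minvdeg_def using assms finite_vars
    by (intro Min_in) (auto simp: nvars_def card_gt_0_iff)
  then show thesis using that by auto
qed

text \<open>Positivity of the deficiency is part of the induction because, applied to the split, it
  yields \<open>i \<le> k\<close>, as the recursion for \<open>NN\<close> demands.\<close>

lemma MU_bound:
  assumes "F \<in> MU"
  shows "deficiency F \<ge> 1 \<and> (nvars F > 0 \<longrightarrow> minvdeg F \<le> NN (nat (deficiency F)))"
  using assms
proof (induction "nvars F" arbitrary: F rule: less_induct)
  case (less F0)
  show ?case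
  proof (cases "nvars F0 = 0")
    case True
    have "F0 \<noteq> {}" using MU_unsat[OF less.prems] by (auto simp: satisfiable_iff)
    then have "card F0 > 0" using MU_finite[OF less.prems] by (simp add: card_gt_0_iff)
    then show ?thesis using True by (simp add: deficiency_def ncls_def)
  next
    case False
    obtain F where F: "F \<in> MU" "saturated F" "vars F = vars F0" "card F = card F0"
      and deg: "\<And>y. ld F0 y \<le> ld F y"
      using saturation_exists[OF less.prems] by metis
    have cF: "is_clause_set F" using MU_clause_set[OF F(1)] .
    have n: "nvars F = nvars F0" and def: "deficiency F = deficiency F0"
      using F by (simp_all add: nvars_def deficiency_def ncls_def)
    have "nvars F > 0" using False n by simp
    then obtain v where v: "v \<in> vars F" "vdeg F v = minvdeg F"
      using minvdeg_attained[OF cF] by metis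
    obtain x where x: "fst x = v" "ld F (comp x) \<le> ld F x"
    proof (cases "ld F (v, True) \<le> ld F (v, False)")
      case True
      then show thesis using that[of "(v, False)"] by (simp add: comp_def)
    next
      case False
      then show thesis using that[of "(v, True)"] by (simp add: comp_def)
    qed
    define i where "i = ld F x"
    let ?G = "split F x"
    have G: "?G \<in> MU" using split_MU[OF F(1,2)] v(1) x(1) by simp
    have cG: "is_clause_set ?G" using MU_clause_set[OF G] .
    have vG: "vars ?G = vars F - {v}"
      using vars_split[OF F(1) G] minvdeg_le[OF cF] v x(1) by simp
    then have nG: "nvars ?G + 1 = nvars F"
      using v(1) finite_vars[OF cF] \<open>nvars F > 0\<close> by (simp add: nvars_def)
    \<comment> \<open>Splitting removes \<open>i\<close> clauses and exactly one variable.\<close>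
    have dG: "deficiency ?G = deficiency F - int i + 1"
      using nG card_split[OF F(1), of x] by (simp add: deficiency_def ncls_def i_def)
    have IH: "deficiency ?G \<ge> 1" "nvars ?G > 0 \<Longrightarrow> minvdeg ?G \<le> NN (nat (deficiency ?G))"
      using less.hyps[OF _ G] nG n by auto
    have i1: "i \<ge> 1" using ld_pos[OF F(1), of x] x(1) v(1) by (simp add: i_def)
    define k where "k = nat (deficiency F)"
    have ik: "int i \<le> deficiency F" using IH(1) dG by linarith
    then have k: "deficiency F = int k" "i \<le> k" by (simp_all add: k_def)
    have m1: "minvdeg F \<le> 2 * i"
      using v x vdeg_eq_ld_comp[of F x] by (simp add: i_def)
    have "minvdeg F \<le> NN k"
    proof (cases "i = 1")
      case True
      then show ?thesis using m1 NN_ge_2[of k] k i1 by linarith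
    next
      case False
      then have i2: "2 \<le> i" using i1 by simp
      \<comment> \<open>If \<open>v\<close> were the only variable, \<open>{x}\<close> would be the
        only clause containing \<open>x\<close>, forcing \<open>i \<le> 1\<close>.\<close>
      have "nvars ?G > 0"
      proof (rule ccontr)
        assume "\<not> nvars ?G > 0"
        then have "vars ?G = {}" using finite_vars[OF cG] by (simp add: nvars_def)
        then have vF: "vars F = {v}" using vG v(1) by blast
        have "C = {x}" if "C \<in> F" "x \<in> C" for C
        proof -
          have "l = x" if "l \<in> C" for l
          proof -
            have "fst l = fst x" using vF x(1) \<open>C \<in> F\<close> that by (auto simp: vars_def)
            then show ?thesis
              using MU_clause[OF F(1) \<open>C \<in> F\<close>] \<open>x \<in> C\<close> that same_var_iff
              unfolding is_clause_iff by metis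
          qed
          then show ?thesis using that by blast
        qed
        then have "{C \<in> F. x \<in> C} \<subseteq> {{x}}" by blast
        then have "i \<le> card {{x}}" unfolding i_def ld_def by (rule card_mono[rotated]) simp
        then show False using i2 by simp
      qed
      then obtain w where w: "w \<in> vars ?G" "vdeg ?G w = minvdeg ?G"
        using minvdeg_attained[OF cG] by metis
      have "nat (deficiency ?G) = k - i + 1" using dG k by simp
      then have "vdeg ?G w \<le> NN (k - i + 1)" using IH(2) w \<open>nvars ?G > 0\<close> by simp
      moreover have "minvdeg F \<le> vdeg F w" using minvdeg_le[OF cF] w(1) vG by blast
      moreover have "vdeg F w \<le> vdeg ?G w + i"
        using vdeg_le_vdeg_split[OF F(1) G] w(1) vG x(1) by (auto simp: i_def)
      ultimately have "minvdeg F \<le> min (2 * i) (NN (k - i + 1) + i)" using m1 by simp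
      then show ?thesis using NN_lower[OF i2 k(2)] by linarith
    qed
    moreover have "minvdeg F0 \<le> minvdeg F"
    proof -
      have "minvdeg F0 \<le> vdeg F0 v"
        using minvdeg_le[OF MU_clause_set[OF less.prems]] v(1) F(3) by simp
      also have "\<dots> \<le> vdeg F v" unfolding vdeg_def by (intro add_mono deg)
      finally show ?thesis using v(2) by simp
    qed
    ultimately show ?thesis using k i1 def by simp
  qed
qed

subsection \<open>The lower bound\<close>

text \<open>The assignment falsifying \<open>C\<close> satisfies every other clause, as each of them
  clashes with \<open>C\<close>.\<close>

lemma UHIT_subset_MU: "UHIT \<subseteq> MU"
proof
  fix F assume F: "F \<in> UHIT"
  have "satisfiable (F - {C})" if C: "C \<in> F" for C
  proof -
    \<comment> \<open>Every literal of \<open>C\<close> becomes false; variables outside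
      \<open>C\<close> get the default False.\<close>
    define \<phi> where "\<phi> = (\<lambda>v. (v, False) \<in> C)"
    have "sat_clause \<phi> D" if D: "D \<in> F" "D \<noteq> C" for D
    proof -
      obtain l where l: "l \<in> D" "comp l \<in> C"
        using F C D unfolding UHIT_def hitting_def by blast
      moreover have "l \<notin> C"
        using F C l(2) comp_comp unfolding UHIT_def is_clause_set_def is_clause_iff
        by blast
      ultimately have "\<phi> (fst l) = snd l"
        by (cases l; cases "snd l") (auto simp: \<phi>_def comp_def)
      then show ?thesis using l(1) by (auto simp: sat_clause_def)
    qed
    then show ?thesis by (auto simp: satisfiable_iff)
  qed
  then show "F \<in> MU" using F by (simp add: UHIT_def MU_def)
qed

text \<open>Merging two clauses that differ only in the sign of one variable lowers the deficiency
  by one. For \<open>k = 4\<close> this yields \<open>[a, b]\<close>, for \<open>k = 3\<close> also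
  \<open>[a', c]\<close>; the merges delete different variables, so the minimum degree drops only to
  6 and then 5. Lists make the parameters computable.\<close>

definition example :: "nat \<Rightarrow> lit set list" where
  "example k = map set (
     let a = (0, True); a' = (0, False); b = (1, True); b' = (1, False);
         c = (2, True); c' = (2, False)
     in if k = 1 then [[a], [a']]
        else if k = 2 then [[a, b], [a, b'], [a', b], [a', b']]
        else if k = 3 then [[a, b], [a', c], [a, b', c], [a, b', c'], [a', b, c'], [a', b', c']]
        else if k = 4 then [[a, b], [a, b', c], [a, b', c'],
               [a', b, c], [a', b, c'], [a', b', c], [a', b', c']]
        else [[a, b, c], [a, b, c'], [a, b', c], [a, b', c'],
               [a', b, c], [a', b, c'], [a', b', c], [a', b', c']])"

lemma example_unsat: "\<not> satisfiable (set (example k))"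
  by (simp add: satisfiable_def example_def Let_def) blast

lemma example_UHIT: "set (example k) \<in> UHIT"
proof -
  have "is_clause_set (set (example k))"
    by (auto simp: example_def Let_def is_clause_set_def is_clause_iff comp_def)
  moreover have "hitting (set (example k))"
    by (simp add: example_def Let_def hitting_def comp_def)
  ultimately show ?thesis using example_unsat by (simp add: UHIT_def)
qed

lemma NN_values: "NN 2 = 4" "NN 3 = 5" "NN 4 = 6" "NN 5 = 8"
proof -
  show 2: "NN 2 = 4" using NN_1 by (subst NN.simps) (simp add: upt_rec)
  show 3: "NN 3 = 5" using NN_1 2 by (subst NN.simps) (simp add: upt_rec)
  show 4: "NN 4 = 6" using NN_1 2 3 by (subst NN.simps) (simp add: upt_rec)
  show "NN 5 = 8" using NN_1 2 3 4 by (subst NN.simps) (simp add: upt_rec numeral_2_eq_2)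
qed

lemma example_parameters:
  assumes "k \<in> {1..5}"
  shows "deficiency (set (example k)) = int k" "nvars (set (example k)) > 0"
    "minvdeg (set (example k)) = NN k"
proof -
  have k: "k = 1 \<or> k = 2 \<or> k = 3 \<or> k = 4 \<or> k = 5" using assms by auto
  \<comment> \<open>An explicit list of indices turns the claim into a closed term that can be
    evaluated.\<close>
  have "\<forall>k\<in>set [1, 2, 3, 4, 5]. deficiency (set (example k)) = int k \<and> nvars (set (example k)) > 0"
    by code_simp
  then show "deficiency (set (example k)) = int k" "nvars (set (example k)) > 0" using k by auto
  have "map (\<lambda>k. minvdeg (set (example k))) [1, 2, 3, 4, 5] = [2, 4, 5, 6, 8]"
    by code_simp
  then show "minvdeg (set (example k)) = NN k" using k NN_1 NN_values by auto
qed

theorem theorem14p1: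
  fixes k :: nat
  assumes "k \<in> {1..5}"
  shows "minvdeg_class (delta_class MU (int k)) = enat (NN k)
       \<and> minvdeg_class (delta_class UHIT (int k)) = enat (NN k)"
proof -
  \<comment> \<open>Both equalities follow at once for any class between \<open>UHIT\<close> and
    \<open>MU\<close>: the upper bound comes from \<open>MU\<close>, the examples lie in
    \<open>UHIT\<close>.\<close>
  have "minvdeg_class (delta_class D (int k)) = enat (NN k)" if D: "UHIT \<subseteq> D" "D \<subseteq> MU" for D
  proof (rule antisym)
    show "minvdeg_class (delta_class D (int k)) \<le> enat (NN k)"
      unfolding minvdeg_class_def
    proof (rule SUP_least)
      fix F assume "F \<in> {F \<in> delta_class D (int k). nvars F > 0}"
      then have "F \<in> MU" "deficiency F = int k" "nvars F > 0"
        using D(2) by (auto simp: delta_class_def)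
      then show "enat (minvdeg F) \<le> enat (NN k)" using MU_bound[of F] by simp
    qed
    let ?E = "set (example k)"
    have "?E \<in> {F \<in> delta_class D (int k). nvars F > 0}"
      using example_parameters[OF assms] example_UHIT D(1) by (auto simp: delta_class_def)
    then show "enat (NN k) \<le> minvdeg_class (delta_class D (int k))"
      unfolding minvdeg_class_def using example_parameters(3)[OF assms] by (metis (lifting) SUP_upper)
  qed
  then show ?thesis using UHIT_subset_MU by blast
qed

end
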